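(* Let $\Delta t>0$, let $n\in\mathbb{N}$ with $n\ge 1$, and let a space-time block have temporal interval $[(n-1)\Delta t,n\Delta t]$ and spatial domain $\Omega\subset\mathbb{R}^M$. Let $\{q_{\mathbf{k}}\}$ be a polynomial basis on $\Omega$, and suppose that on this block $$u(t,\mathbf{x})=\sum_{j,\mathbf{k}}u_{j,\mathbf{k}}\,p_j^{(n)}(t)\,q_{\mathbf{k}}(\mathbf{x}).$$ If the time basis $\{p_j^{(n)}\}_{j\ge0}$ consists of the shifted Legendre polynomials $p_j^{(n)}(t)=P_j(m_n(t))$, then $$u(n\Delta t,\mathbf{x})=\sum_{\mathbf{k}}\Bigl(\sum_j u_{j,\mathbf{k}}\Bigr)q_{\mathbf{k}}(\mathbf{x}).$$ The same identity holds if the time basis consists of the shifted Chebyshev polynomials of the first kind $p_j^{(n)}(t)=T_j(m_n(t))$.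
   Context: The expansions are truncated (finite sums), with coefficients $u_{j,\mathbf{k}}$, time index $j\ge0$ and spatial (multi-)index $\mathbf{k}$. $P_j$ and $T_j$ are the standard degree-$j$ Legendre polynomial and Chebyshev polynomial of the first kind on $[-1,1]$. $m_n(t)=\frac{2t-(2n-1)\Delta t}{\Delta t}$ is the affine bijection of $[(n-1)\Delta t,n\Delta t]$ onto $[-1,1]$. *)

theory Defs
  imports "HOL-Analysis.Analysis" "HOL-Computational_Algebra.Polynomial"
begin

(* Rodrigues' formula: P_j = 1/(2^j j!) (d/dX)^j (X^2 - 1)^j *)
definition legendre_poly :: "nat \<Rightarrow> real poly" where
  "legendre_poly j = smult (1 / (2 ^ j * fact j)) ((pderiv ^^ j) ([:-1, 0, 1:] ^ j))"

fun chebyshev_poly :: "nat \<Rightarrow> real poly" where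
  "chebyshev_poly 0 = 1"
| "chebyshev_poly (Suc 0) = [:0, 1:]"
| "chebyshev_poly (Suc (Suc j)) = [:0, 2:] * chebyshev_poly (Suc j) - chebyshev_poly j"

definition time_interval :: "real \<Rightarrow> nat \<Rightarrow> real set" where
  "time_interval dt n = {(real n - 1) * dt .. real n * dt}"

definition time_map :: "real \<Rightarrow> nat \<Rightarrow> real \<Rightarrow> real" where
  "time_map dt n t = (2 * t - (2 * real n - 1) * dt) / dt"

definition shifted_legendre :: "real \<Rightarrow> nat \<Rightarrow> nat \<Rightarrow> real \<Rightarrow> real" where
  "shifted_legendre dt n j t = poly (legendre_poly j) (time_map dt n t)"

definition shifted_chebyshev :: "real \<Rightarrow> nat \<Rightarrow> nat \<Rightarrow> real \<Rightarrow> real" where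
  "shifted_chebyshev dt n j t = poly (chebyshev_poly j) (time_map dt n t)"

definition polynomial_space :: "('a::real_normed_vector \<Rightarrow> real) set \<Rightarrow> bool" where
  "polynomial_space V \<longleftrightarrow>
     (\<forall>f\<in>V. real_polynomial_function f) \<and>
     (\<lambda>x. 0) \<in> V \<and>
     (\<forall>f\<in>V. \<forall>g\<in>V. (\<lambda>x. f x + g x) \<in> V) \<and>
     (\<forall>c. \<forall>f\<in>V. (\<lambda>x. c * f x) \<in> V)"

(* The family q, indexed by K, is a basis of the polynomial space V, where polynomials are
   regarded as functions on Omega: linear independence and spanning only concern values on Omega.
   V may be the space of all polynomial functions or, e.g., those of bounded degree. *)
definition polynomial_basis_on ::
  "('a::real_normed_vector) set \<Rightarrow> ('a \<Rightarrow> real) set \<Rightarrow> 'k set \<Rightarrow> ('k \<Rightarrow> 'a \<Rightarrow> real) \<Rightarrow> bool" where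
  "polynomial_basis_on \<Omega> V K q \<longleftrightarrow>
     polynomial_space V \<and>
     (\<forall>k\<in>K. q k \<in> V) \<and>
     (\<forall>F c. finite F \<and> F \<subseteq> K \<and> (\<forall>x\<in>\<Omega>. (\<Sum>k\<in>F. c k * q k x) = 0) \<longrightarrow> (\<forall>k\<in>F. c k = 0)) \<and>
     (\<forall>f\<in>V. \<exists>F c. finite F \<and> F \<subseteq> K \<and> (\<forall>x\<in>\<Omega>. f x = (\<Sum>k\<in>F. c k * q k x)))"

end

theory Submission
  imports Defs
begin

text \<open>The affine map \<open>time_map\<close> sends the right endpoint of the time interval to
  1, and P_j(1) = T_j(1) = 1 for all j. Hence every time factor is 1 there, and it remains to
  collect terms with the same spatial index (\<open>sum_group_by_snd\<close>). The value T_j(1) is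
  immediate from the recurrence; P_j(1) comes from Rodrigues' formula by way of
  \<open>poly_higher_pderiv_linear_power_mult\<close>.\<close>

text \<open>By Leibniz, only the term in which all j derivatives fall on the power survives at a.
  The induction needs arbitrary g, since each derivative changes the cofactor.\<close>

lemma poly_higher_pderiv_linear_power_mult:
  fixes a :: "'a::{idom, ring_char_0}"
  shows "poly ((pderiv ^^ j) ([:-a, 1:] ^ j * g)) a = fact j * poly g a"
proof (induction j arbitrary: g)
  case (Suc j)
  have "pderiv ([:-a, 1:] ^ Suc j * g)
      = [:-a, 1:] ^ j * (smult (of_nat (Suc j)) g + [:-a, 1:] * pderiv g)"
    by (simp only: pderiv_mult pderiv_power_Suc) (simp add: pderiv_pCons algebra_simps)
  then have "poly ((pderiv ^^ Suc j) ([:-a, 1:] ^ Suc j * g)) a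
      = fact j * poly (smult (of_nat (Suc j)) g + [:-a, 1:] * pderiv g) a"
    \<comment> \<open>The innermost derivative is peeled off, so that the induction hypothesis
      applies to the new cofactor.\<close>
    by (simp only: funpow_Suc_right o_apply Suc.IH)
  then show ?case
    by (simp add: algebra_simps)
qed simp

text \<open>Factoring X^2 - 1 = (X - 1)(X + 1) gives the cofactor (X + 1)^j. The derivative at 1 is
  therefore j! 2^j, which the normalisation cancels.\<close>

lemma poly_legendre_poly_1: "poly (legendre_poly j) 1 = 1"
proof -
  have "([:-1, 0, 1:] :: real poly) ^ j = [:-1, 1:] ^ j * [:1, 1:] ^ j"
    by (simp flip: power_mult_distrib)
  then show ?thesis
    using poly_higher_pderiv_linear_power_mult[of j "1::real" "[:1, 1:] ^ j"]
    by (simp add: legendre_poly_def poly_power)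
qed

lemma poly_chebyshev_poly_1: "poly (chebyshev_poly j) 1 = 1"
  by (induction j rule: chebyshev_poly.induct) simp_all

lemma time_map_right_endpoint: "dt \<noteq> 0 \<Longrightarrow> time_map dt n (real n * dt) = 1"
  by (simp add: time_map_def field_simps)

text \<open>\<open>S\<close> need not be a rectangle, so the inner sum runs over the fibre of
  \<open>S\<close> above k.\<close>

lemma sum_group_by_snd:
  fixes a :: "'j \<Rightarrow> 'k \<Rightarrow> 'a::semiring_0"
  assumes "finite S"
  shows "(\<Sum>(j, k)\<in>S. a j k * b k) = (\<Sum>k\<in>snd ` S. (\<Sum>j | (j, k) \<in> S. a j k) * b k)"
proof -
  have "(\<Sum>(j, k)\<in>S. a j k * b k)
      = (\<Sum>k\<in>snd ` S. \<Sum>x\<in>{x\<in>S. snd x = k}. case x of (j, k) \<Rightarrow> a j k * b k)"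
    by (rule sum.image_gen[OF assms])
  also have "\<dots> = (\<Sum>k\<in>snd ` S. \<Sum>j | (j, k) \<in> S. a j k * b k)"
    by (intro sum.cong refl sum.reindex_bij_witness[where i = "\<lambda>j. (j, _)" and j = fst]) auto
  finally show ?thesis
    by (simp add: sum_distrib_right)
qed

theorem corollary3p2:
  fixes dt :: real and n :: nat
    and \<Omega> :: "(real ^ 'm) set"
    and V :: "(real ^ 'm \<Rightarrow> real) set"
    and K :: "'k set" and q :: "'k \<Rightarrow> real ^ 'm \<Rightarrow> real"
    and S :: "(nat \<times> 'k) set" and c :: "nat \<Rightarrow> 'k \<Rightarrow> real"
    and p :: "nat \<Rightarrow> real \<Rightarrow> real"
    and u :: "real \<Rightarrow> real ^ 'm \<Rightarrow> real"
  assumes "dt > 0" and "n \<ge> 1"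
    and "polynomial_basis_on \<Omega> V K q"
    and "finite S" and "S \<subseteq> UNIV \<times> K"
    and "\<forall>t\<in>time_interval dt n. \<forall>x\<in>\<Omega>. u t x = (\<Sum>(j, k)\<in>S. c j k * p j t * q k x)"
  shows "((\<forall>j. \<forall>t\<in>time_interval dt n. p j t = shifted_legendre dt n j t) \<longrightarrow>
           (\<forall>x\<in>\<Omega>. u (real n * dt) x = (\<Sum>k\<in>snd ` S. (\<Sum>j | (j, k) \<in> S. c j k) * q k x))) \<and>
         ((\<forall>j. \<forall>t\<in>time_interval dt n. p j t = shifted_chebyshev dt n j t) \<longrightarrow>
           (\<forall>x\<in>\<Omega>. u (real n * dt) x = (\<Sum>k\<in>snd ` S. (\<Sum>j | (j, k) \<in> S. c j k) * q k x)))"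
proof -
  have t: "real n * dt \<in> time_interval dt n"
    using assms(1) by (simp add: time_interval_def)
  \<comment> \<open>Both bases enter only through their endpoint value 1, so one argument serves
    both.\<close>
  have *: "\<forall>x\<in>\<Omega>. u (real n * dt) x = (\<Sum>k\<in>snd ` S. (\<Sum>j | (j, k) \<in> S. c j k) * q k x)"
    if "\<And>j. p j (real n * dt) = 1"
    using t assms(6) that by (simp add: sum_group_by_snd[OF assms(4), of c, symmetric])
  show ?thesis
    using * t assms(1)
    by (simp add: shifted_legendre_def shifted_chebyshev_def time_map_right_endpoint
        poly_legendre_poly_1 poly_chebyshev_poly_1)
qed

end
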